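(* Let $A=A^\top\in\mathbb{R}^{3\times3}$ be such that $W=\mathrm{tr}(A)I-A$ is symmetric positive definite, with eigenvalues $\lambda_1^A,\lambda_2^A,\lambda_3^A$ and orthonormal eigenbasis $v_1,v_2,v_3$, $v_i$ being the unit eigenvector corresponding to $\lambda_i^A$. A unit vector $u\in\mathbb{S}^2$ that solves the maximization problem $$\max_{u\in\mathbb{S}^2}\Big(\min_{v\in\mathcal{E}(A)}\Delta(v,u)\Big)$$ satisfies the following. (i) If $A$ has two distinct eigenvalues $0<\lambda_1^A=\lambda_2^A<\lambda_3^A$, then $$(u^\top v_3)^2=1-\frac{\lambda_2^A}{\lambda_3^A}.$$ (ii) If $A$ has three distinct eigenvalues $0<\lambda_1^A<\lambda_2^A<\lambda_3^A$, then $$u^\top v_1=0,\qquad (u^\top v_2)^2=\frac{\lambda_2^A}{\lambda_2^A+\lambda_3^A},\qquad (u^\top v_3)^2=\frac{\lambda_3^A}{\lambda_2^A+\lambda_3^A}$$ if $\lambda_2^A\ge\lambda_1^A\lambda_3^A/(\lambda_3^A-\lambda_1^A)$; otherwise, $$(u^\top v_i)^2=1-4\,\frac{\prod_{j\neq i}\lambda_j^A}{\sum_{j\neq k}\lambda_j^A\lambda_k^A},\qquad i\in\{1,2,3\},$$ where the sum in the denominator is over all ordered pairs $(j,k)\in\{1,2,3\}^2$ with $j\ne k$.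
   Context: $\mathcal{E}(A)$ is the set of real unit eigenvectors of $A$; $\lambda_i^W=\mathrm{tr}(A)-\lambda_i^A$ is the eigenvalue of $W$ for $v_i$. The quantity $\Delta(v,u)$, with $\Delta(-v,u)=\Delta(v,u)$, is given as follows. If $\lambda_1^A=\lambda_2^A\neq\lambda_3^A$ (so $\mathcal{E}(A)$ consists of $\pm v_3$ and all unit vectors $v_{12}\in\mathrm{span}\{v_1,v_2\}$): $\Delta(v_{12},u)=(1-(u^\top v_3)^2)\,[\lambda_2^W-\lambda_3^W\sin^2\phi]$ with $\phi=\angle(v_{12},u^\perp)$, $u^\perp$ the orthogonal projection of $u$ on $\mathrm{span}\{v_1,v_2\}$ (the value is $0$ if $u^\perp=0$); $\Delta(v_3,u)=\lambda_3^W-\lambda_2^W(1-(u^\top v_3)^2)$. If $0<\lambda_1^A<\lambda_2^A<\lambda_3^A$ (so $\mathcal{E}(A)=\{\pm v_1,\pm v_2,\pm v_3\}$): $\Delta(v_1,u)=\lambda_1^W-(u^\top v_2)^2\lambda_3^W-(u^\top v_3)^2\lambda_2^W$, $\Delta(v_2,u)=\lambda_2^W-(u^\top v_3)^2\lambda_1^W-(u^\top v_1)^2\lambda_3^W$, $\Delta(v_3,u)=\lambda_3^W-(u^\top v_1)^2\lambda_2^W-(u^\top v_2)^2\lambda_1^W$. *)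

theory Defs
  imports "HOL-Analysis.Analysis"
begin

definition positive_definite :: "real^'n^'n \<Rightarrow> bool" where
  "positive_definite M \<longleftrightarrow> (\<forall>x. x \<noteq> 0 \<longrightarrow> x \<bullet> (M *v x) > 0)"

definition W_matrix :: "real^3^3 \<Rightarrow> real^3^3" where
  "W_matrix A = trace A *\<^sub>R mat 1 - A"

definition unit_eigenvectors :: "real^3^3 \<Rightarrow> (real^3) set" where
  "unit_eigenvectors A = {v. norm v = 1 \<and> (\<exists>c. A *v v = c *\<^sub>R v)}"

text \<open>Three orthonormal vectors of \<open>\<real>\<^sup>3\<close> automatically form a basis, so spanning is not
  required separately. The index type \<open>3\<close> has the elements \<open>1\<close>, \<open>2\<close>, \<open>3\<close> (with \<open>3 = 0\<close>).\<close>

definition orthonormal_eigenbasis :: "real^3^3 \<Rightarrow> (3 \<Rightarrow> real) \<Rightarrow> (3 \<Rightarrow> real^3) \<Rightarrow> bool" where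
  "orthonormal_eigenbasis A lam v \<longleftrightarrow>
     (\<forall>i. norm (v i) = 1) \<and>
     (\<forall>i j. i \<noteq> j \<longrightarrow> orthogonal (v i) (v j)) \<and>
     (\<forall>i. A *v v i = lam i *\<^sub>R v i)"

definition lamW :: "real^3^3 \<Rightarrow> (3 \<Rightarrow> real) \<Rightarrow> 3 \<Rightarrow> real" where
  "lamW A lam i = trace A - lam i"

definition orth_projection :: "'a::euclidean_space set \<Rightarrow> 'a \<Rightarrow> 'a" where
  "orth_projection S u = (THE p. p \<in> S \<and> (\<forall>w\<in>S. orthogonal w (u - p)))"

definition vec_angle :: "'a::real_inner \<Rightarrow> 'a \<Rightarrow> real" where
  "vec_angle x y = arccos ((x \<bullet> y) / (norm x * norm y))"

text \<open>\<open>Delta A lam v x u\<close> is $\Delta(x,u)$ for a unit eigenvector \<open>x\<close> of \<open>A\<close>, computed from the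
  eigenvalues \<open>lam\<close> and the orthonormal eigenbasis \<open>v\<close>. It is only meaningful for the two
  eigenvalue patterns below; testing \<open>x\<close> against both signs encodes $\Delta(-x,u)=\Delta(x,u)$.
  The condition \<open>x \<in> span {v 1, v 2}\<close> covers every other unit eigenvector in the first pattern.\<close>

definition Delta ::
  "real^3^3 \<Rightarrow> (3 \<Rightarrow> real) \<Rightarrow> (3 \<Rightarrow> real^3) \<Rightarrow> real^3 \<Rightarrow> real^3 \<Rightarrow> real" where
  "Delta A lam v x u =
    (if lam 1 = lam 2 \<and> lam 2 \<noteq> lam 3 then
       if x = v 3 \<or> x = - v 3 then
         lamW A lam 3 - lamW A lam 2 * (1 - (u \<bullet> v 3)\<^sup>2)
       else if x \<in> span {v 1, v 2} then
         (let p = orth_projection (span {v 1, v 2}) u in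
            if p = 0 then 0
            else (1 - (u \<bullet> v 3)\<^sup>2) *
                 (lamW A lam 2 - lamW A lam 3 * (sin (vec_angle x p))\<^sup>2))
       else undefined
     else if 0 < lam 1 \<and> lam 1 < lam 2 \<and> lam 2 < lam 3 then
       if x = v 1 \<or> x = - v 1 then
         lamW A lam 1 - (u \<bullet> v 2)\<^sup>2 * lamW A lam 3 - (u \<bullet> v 3)\<^sup>2 * lamW A lam 2
       else if x = v 2 \<or> x = - v 2 then
         lamW A lam 2 - (u \<bullet> v 3)\<^sup>2 * lamW A lam 1 - (u \<bullet> v 1)\<^sup>2 * lamW A lam 3
       else if x = v 3 \<or> x = - v 3 then
         lamW A lam 3 - (u \<bullet> v 1)\<^sup>2 * lamW A lam 2 - (u \<bullet> v 2)\<^sup>2 * lamW A lam 1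
       else undefined
     else undefined)"

text \<open>In both eigenvalue patterns the infimum below is attained, hence a genuine minimum: for
  distinct eigenvalues the set of unit eigenvectors is finite, and for \<open>0 < lam 1 = lam 2 < lam 3\<close>
  the values on the unit circle of \<open>span {v 1, v 2}\<close> are smallest where \<open>x\<close> is orthogonal to the
  projection of \<open>u\<close>.\<close>

definition min_Delta :: "real^3^3 \<Rightarrow> (3 \<Rightarrow> real) \<Rightarrow> (3 \<Rightarrow> real^3) \<Rightarrow> real^3 \<Rightarrow> real" where
  "min_Delta A lam v u = (INF x\<in>unit_eigenvectors A. Delta A lam v x u)"

definition solves_maxmin :: "real^3^3 \<Rightarrow> (3 \<Rightarrow> real) \<Rightarrow> (3 \<Rightarrow> real^3) \<Rightarrow> real^3 \<Rightarrow> bool" where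
  "solves_maxmin A lam v u \<longleftrightarrow> is_arg_max (min_Delta A lam v) (\<lambda>w. w \<in> sphere 0 1) u"

end

theory Submission
  imports Defs
begin

text \<open>For fixed \<open>u\<close> the minimum over the unit eigenvectors is a minimum of two or three affine
  functions of the squared coordinates \<open>s\<^sub>i = (u \<bullet> v i)\<^sup>2\<close>, which range over the standard simplex.
  A suitable convex combination of these functions is maximal on the simplex at the claimed point,
  where the functions of positive weight all agree. At a maximizer they must therefore agree as
  well, with the same value, and this determines \<open>s\<close>.\<close>

section \<open>Orthogonal projections, angles and maximizers\<close>

text \<open>Turns the definite description into a checkable criterion. For two candidates
  \<open>p\<close> and \<open>q\<close>, the difference \<open>q - p\<close> lies in
  \<open>S\<close> and is orthogonal to both \<open>u - p\<close> and \<open>u - q\<close>, hence to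
  itself.\<close>

lemma orth_projection_eqI:
  assumes "subspace S" "p \<in> S" "\<And>w. w \<in> S \<Longrightarrow> orthogonal w (u - p)"
  shows "orth_projection S u = p"
  unfolding orth_projection_def
proof (rule the_equality)
  fix q assume q: "q \<in> S \<and> (\<forall>w\<in>S. orthogonal w (u - q))"
  have "q - p \<in> S" using assms(1,2) q subspace_diff by blast
  then have "(q - p) \<bullet> (u - p) = 0" "(q - p) \<bullet> (u - q) = 0"
    using assms(3) q by (auto simp: orthogonal_def)
  then have "(q - p) \<bullet> (q - p) = 0" by (simp add: inner_diff_right)
  then show "q = p" by simp
qed (use assms in auto)

lemma sin_squared_vec_angle:
  "(sin (vec_angle x y))\<^sup>2 = 1 - (x \<bullet> y / (norm x * norm y))\<^sup>2"
proof -
  have "\<bar>x \<bullet> y\<bar> \<le> norm x * norm y" by (rule Cauchy_Schwarz_ineq2)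
  then have "\<bar>x \<bullet> y / (norm x * norm y)\<bar> \<le> 1"
    \<comment> \<open>For a zero vector the quotient is 0 by the convention on division by zero, so
      the bound survives and no nonzero assumption enters.\<close>
    by (cases "x = 0 \<or> y = 0") (auto simp: abs_mult)
  then have "cos (vec_angle x y) = x \<bullet> y / (norm x * norm y)"
    unfolding vec_angle_def by (rule cos_arccos_abs)
  then show ?thesis by (simp add: sin_squared_eq)
qed

lemma solves_maxmin_ge:
  assumes "solves_maxmin A lam v u" "norm w = 1"
  shows "min_Delta A lam v w \<le> min_Delta A lam v u"
  using assms by (auto simp: solves_maxmin_def is_arg_max_def not_less)

section \<open>Optimal points of the affine functions on the simplex\<close>

text \<open>Here \<open>t\<close> stands for the squared third coordinate. The first function
  increases in \<open>t\<close>, the second decreases, and they cross at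
  \<open>t = 1 - b / c\<close> with value \<open>(c - b) * b / c\<close>. If both reach that value,
  \<open>t\<close> is bounded from both sides by the crossing point.\<close>

lemma maxmin_equal_pair:
  fixes b c t :: real
  assumes "0 < b" "b < c"
    and "(c - b) * b / c \<le> 2 * b - (b + c) * (1 - t)"
    and "(c - b) * b / c \<le> (1 - t) * (c - b)"
  shows "t = 1 - b / c"
proof (rule antisym)
  have "b / c * (c - b) \<le> (1 - t) * (c - b)" using assms(4) by (simp add: mult.commute)
  then have "b / c \<le> 1 - t" by (rule mult_right_le_imp_le) (use assms(2) in simp)
  then show "t \<le> 1 - b / c" by simp
  have "(c - b) * b / c = 2 * b - (b + c) * (b / c)"
    using assms(1,2) by (simp add: field_simps)
  then have "(b + c) * (1 - t) \<le> (b + c) * (b / c)" using assms(3) by linarith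
  then have "1 - t \<le> b / c" by (rule mult_left_le_imp_le) (use assms(1,2) in simp)
  then show "1 - b / c \<le> t" by simp
qed

text \<open>On the plane \<open>s1 + s2 + s3 = 1\<close> the functions of the second and third
  eigenvector add up to \<open>2 * a - 2 * (a * s1)\<close>. Both being at least \<open>a\<close>
  thus forces \<open>s1 = 0\<close>; the bounds left for \<open>s2\<close> and \<open>s3\<close>
  then sum to an equality, so each is tight.\<close>

lemma maxmin_boundary:
  fixes a b c s1 s2 s3 :: real
  assumes "0 < a" "0 < b" "0 < c" "0 \<le> s1" and sum: "s1 + s2 + s3 = 1"
    and 2: "a \<le> a + c - s3 * (b + c) - s1 * (a + b)"
    and 3: "a \<le> a + b - s1 * (a + c) - s2 * (b + c)"
  shows "s1 = 0" "s2 = b / (b + c)" "s3 = c / (b + c)"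
proof -
  have "(a + c - s3 * (b + c) - s1 * (a + b)) + (a + b - s1 * (a + c) - s2 * (b + c))
      = 2 * a + (b + c) * (1 - (s1 + s2 + s3)) - 2 * (a * s1)"
    by (simp add: algebra_simps)
  then have "a * s1 \<le> 0" using 2 3 sum by simp
  then show "s1 = 0" using assms(1,4) by (simp add: mult_le_0_iff)
  then have "s3 * (b + c) \<le> c" "s2 * (b + c) \<le> b" using 2 3 by auto
  moreover have "s2 * (b + c) + s3 * (b + c) = b + c"
    using sum \<open>s1 = 0\<close> by (metis add_0 distrib_right mult_1)
  ultimately have "s2 * (b + c) = b" "s3 * (b + c) = c" by linarith+
  then show "s2 = b / (b + c)" "s3 = c / (b + c)" using assms(2,3) by (auto simp: field_simps)
qed

text \<open>The weights \<open>a (b + c)\<close>, \<open>b (a + c)\<close>, \<open>c (a + b)\<close> below solve the linear system expressing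
  that the weighted sum of the three functions is constant on the plane \<open>s1 + s2 + s3 = 1\<close>; the
  common value of the functions at the optimum is \<open>2 a b c / (a b + b c + c a)\<close>.\<close>

lemma maxmin_interior:
  fixes a b c s1 s2 s3 :: real
  defines "S \<equiv> a * b + b * c + c * a"
  assumes pos: "0 < a" "0 < b" "0 < c" and sum: "s1 + s2 + s3 = 1"
    and 1: "2 * a * b * c / S \<le> b + c - s2 * (a + b) - s3 * (a + c)"
    and 2: "2 * a * b * c / S \<le> a + c - s3 * (b + c) - s1 * (a + b)"
    and 3: "2 * a * b * c / S \<le> a + b - s1 * (a + c) - s2 * (b + c)"
  shows "s1 = 1 - 2 * (b * c) / S" "s2 = 1 - 2 * (a * c) / S" "s3 = 1 - 2 * (a * b) / S"
proof -
  define V where "V = 2 * a * b * c / S"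
  have S: "S > 0" using pos by (simp add: S_def add_pos_pos)
  have VS: "V * S = 2 * a * b * c" using S by (simp add: V_def)
  define e1 where "e1 = b + c - s2 * (a + b) - s3 * (a + c) - V"
  define e2 where "e2 = a + c - s3 * (b + c) - s1 * (a + b) - V"
  define e3 where "e3 = a + b - s1 * (a + c) - s2 * (b + c) - V"
  have e: "0 \<le> e1" "0 \<le> e2" "0 \<le> e3"
    using 1 2 3 by (auto simp: e1_def e2_def e3_def V_def)
  have s3: "s3 = 1 - s1 - s2" using sum by simp
  have "a * (b + c) * e1 + b * (a + c) * e2 + c * (a + b) * e3 = 4 * a * b * c - 2 * (V * S)"
    unfolding e1_def e2_def e3_def s3 S_def by algebra
  then have 0: "a * (b + c) * e1 + b * (a + c) * e2 + c * (a + b) * e3 = 0" using VS by simp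
  have w: "0 < a * (b + c)" "0 < b * (a + c)" "0 < c * (a + b)" using pos by simp_all
  have "0 \<le> a * (b + c) * e1" "0 \<le> b * (a + c) * e2" "0 \<le> c * (a + b) * e3"
    using w e by (simp_all del: mult_pos_pos)
  then have "a * (b + c) * e1 = 0" "b * (a + c) * e2 = 0" "c * (a + b) * e3 = 0"
    using 0 by linarith+
  then have E: "e1 = 0" "e2 = 0" "e3 = 0" using w by auto
  \<comment> \<open>Adding two of the three equations isolates a single coordinate, which solves the
    linear system.\<close>
  have "e2 + e3 = 2 * (a * (1 - s1) - V)" "e1 + e3 = 2 * (b * (1 - s2) - V)"
      "e1 + e2 = 2 * (c * (1 - s3) - V)"
    unfolding e1_def e2_def e3_def s3 by algebra+
  then have "a * (1 - s1) = V" "b * (1 - s2) = V" "c * (1 - s3) = V" using E by simp_all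
  then have "1 - s1 = V / a" "1 - s2 = V / b" "1 - s3 = V / c" using pos by (simp_all add: field_simps)
  moreover have "V / a = 2 * (b * c) / S" "V / b = 2 * (a * c) / S" "V / c = 2 * (a * b) / S"
    using pos S by (simp_all add: V_def field_simps)
  ultimately show "s1 = 1 - 2 * (b * c) / S" "s2 = 1 - 2 * (a * c) / S" "s3 = 1 - 2 * (a * b) / S"
    by linarith+
qed

section \<open>Coordinates in the eigenbasis\<close>

context
  fixes A :: "real^3^3" and lam :: "3 \<Rightarrow> real" and v :: "3 \<Rightarrow> real^3"
  assumes basis: "orthonormal_eigenbasis A lam v"
begin

lemma eigenbasis_inner: "v i \<bullet> v j = (if i = j then 1 else 0)"
  using basis by (auto simp: orthonormal_eigenbasis_def orthogonal_def norm_eq_1)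

lemma eigenbasis_eigen: "A *v v i = lam i *\<^sub>R v i"
  using basis by (simp add: orthonormal_eigenbasis_def)

lemma orthogonal_matrix_eigenbasis: "orthogonal_matrix (\<chi> i. v i)"
  unfolding orthogonal_matrix_orthonormal_rows
  using basis by (auto simp: row_def orthonormal_eigenbasis_def)

lemma eigenbasis_expand: "x = (\<Sum>i\<in>UNIV. (x \<bullet> v i) *\<^sub>R v i)"
proof -
  have "x = transpose (\<chi> i. v i) *v ((\<chi> i. v i) *v x)"
    using orthogonal_matrix_eigenbasis
    by (simp add: orthogonal_matrix_def matrix_vector_mul_assoc)
  also have "\<dots> = (\<Sum>i\<in>UNIV. (x \<bullet> v i) *\<^sub>R v i)"
    by (simp add: vec_eq_iff matrix_vector_mult_def transpose_def inner_vec_def mult.commute)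
  finally show ?thesis .
qed

lemma inner_eigenbasis: "x \<bullet> y = (\<Sum>i\<in>UNIV. (x \<bullet> v i) * (y \<bullet> v i))"
proof -
  have "x \<bullet> y = x \<bullet> (\<Sum>i\<in>UNIV. (y \<bullet> v i) *\<^sub>R v i)" by (simp flip: eigenbasis_expand)
  then show ?thesis by (simp add: inner_sum_right mult.commute)
qed

text \<open>Parseval's identity: the squared coordinates of a unit vector form a point of the
  standard simplex.\<close>

lemma norm_eigenbasis: "(norm x)\<^sup>2 = (x \<bullet> v 1)\<^sup>2 + (x \<bullet> v 2)\<^sup>2 + (x \<bullet> v 3)\<^sup>2"
  using inner_eigenbasis[of x x] by (simp add: dot_square_norm power2_eq_square sum_3)

lemma eigenbasis_eqI:
  assumes "x \<bullet> v 1 = y \<bullet> v 1" "x \<bullet> v 2 = y \<bullet> v 2" "x \<bullet> v 3 = y \<bullet> v 3"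
  shows "x = y"
  by (subst eigenbasis_expand[of x], subst eigenbasis_expand[of y]) (simp add: sum_3 assms)

text \<open>By cyclicity the trace is that of \<open>P ** A ** transpose P\<close>, with the basis
  vectors as rows of \<open>P\<close>; the diagonal entries of this product are
  \<open>v i \<bullet> (A *v v i)\<close>.\<close>

lemma trace_eigenbasis: "trace A = lam 1 + lam 2 + lam 3"
proof -
  define P :: "real^3^3" where "P = (\<chi> i. v i)"
  have "transpose P ** P = mat 1"
    using orthogonal_matrix_eigenbasis by (simp add: P_def orthogonal_matrix_def)
  then have "trace A = trace ((A ** transpose P) ** P)"
    by (simp add: matrix_mul_assoc[symmetric])
  also have "\<dots> = trace (P ** (A ** transpose P))" by (rule trace_mul_sym)
  also have "\<dots> = (\<Sum>i\<in>UNIV. v i \<bullet> (A *v v i))"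
    by (simp add: trace_def matrix_matrix_mult_def P_def inner_vec_def transpose_def
        matrix_vector_mult_def)
  finally show ?thesis by (simp add: eigenbasis_eigen eigenbasis_inner sum_3)
qed

lemma lamW_eigenbasis:
  "lamW A lam 1 = lam 2 + lam 3" "lamW A lam 2 = lam 1 + lam 3" "lamW A lam 3 = lam 1 + lam 2"
  by (simp_all add: lamW_def trace_eigenbasis)

text \<open>\<open>A\<close> acts diagonally on coordinates, so an eigenvector for \<open>m\<close>
  has nonzero coordinates only where \<open>lam i = m\<close>. Finding the eigenvectors becomes a
  comparison of eigenvalues.\<close>

lemma unit_eigenvector_iff:
  "x \<in> unit_eigenvectors A \<longleftrightarrow>
    norm x = 1 \<and> (\<exists>m. \<forall>i. (lam i - m) * (x \<bullet> v i) = 0)"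
proof -
  have "A *v x = (\<Sum>i\<in>UNIV. ((x \<bullet> v i) * lam i) *\<^sub>R v i)"
    by (subst eigenbasis_expand[of x])
      (simp add: sum_3 matrix_vector_right_distrib matrix_vector_mult_scaleR eigenbasis_eigen)
  then have Ax: "(A *v x) \<bullet> v i = lam i * (x \<bullet> v i)" for i
    using exhaust_3[of i] by (auto simp: sum_3 inner_add_left eigenbasis_inner)
  have "A *v x = m *\<^sub>R x \<longleftrightarrow> (\<forall>i. lam i * (x \<bullet> v i) = m * (x \<bullet> v i))" for m
  proof
    assume "A *v x = m *\<^sub>R x"
    then show "\<forall>i. lam i * (x \<bullet> v i) = m * (x \<bullet> v i)"
      unfolding Ax[symmetric] by simp
  next
    assume "\<forall>i. lam i * (x \<bullet> v i) = m * (x \<bullet> v i)"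
    then show "A *v x = m *\<^sub>R x"
      by (intro eigenbasis_eqI) (simp_all only: Ax inner_scaleR_left)
  qed
  then show ?thesis
    by (simp only: unit_eigenvectors_def mem_Collect_eq left_diff_distrib right_minus_eq)
qed

lemma eigenbasis_neq: "i \<noteq> j \<Longrightarrow> v i \<noteq> v j \<and> v i \<noteq> - v j"
  using eigenbasis_inner[of i j] eigenbasis_inner[of j j] by auto

lemma unit_along_axis:
  assumes "norm x = 1" "\<And>j. j \<noteq> i \<Longrightarrow> x \<bullet> v j = 0"
  shows "x = v i \<or> x = - v i"
proof -
  have "x = (x \<bullet> v i) *\<^sub>R v i"
    using eigenbasis_expand[of x] assms(2) by (subst (asm) sum.remove[of _ i]) auto
  moreover from this have "\<bar>x \<bullet> v i\<bar> = 1"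
    using assms(1) basis by (metis mult.right_neutral norm_scaleR orthonormal_eigenbasis_def)
  ultimately show ?thesis by (metis abs_eq_iff' abs_1 scaleR_minus1_left scaleR_one)
qed

text \<open>Realizes every point of the simplex, so that maximizers can be compared with the vector
  having the claimed coordinates.\<close>

lemma exists_unit_vector_coordinates:
  assumes "0 \<le> s1" "0 \<le> s2" "0 \<le> s3" "s1 + s2 + s3 = 1"
  obtains w where "norm w = 1" "(w \<bullet> v 1)\<^sup>2 = s1" "(w \<bullet> v 2)\<^sup>2 = s2" "(w \<bullet> v 3)\<^sup>2 = s3"
proof -
  define w where "w = sqrt s1 *\<^sub>R v 1 + sqrt s2 *\<^sub>R v 2 + sqrt s3 *\<^sub>R v 3"
  have s: "(w \<bullet> v 1)\<^sup>2 = s1" "(w \<bullet> v 2)\<^sup>2 = s2" "(w \<bullet> v 3)\<^sup>2 = s3"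
    using assms by (auto simp: w_def inner_add_left eigenbasis_inner)
  then have "(norm w)\<^sup>2 = 1" using assms by (simp add: norm_eigenbasis)
  then have "norm w = 1" using norm_ge_zero[of w] by (simp add: power2_eq_1_iff)
  then show thesis using s that by blast
qed

section \<open>The inner minimum for three distinct eigenvalues\<close>

lemma min_Delta_distinct:
  assumes lt: "0 < lam 1" "lam 1 < lam 2" "lam 2 < lam 3"
  shows "min_Delta A lam v u = Min
    {lam 2 + lam 3 - (u \<bullet> v 2)\<^sup>2 * (lam 1 + lam 2) - (u \<bullet> v 3)\<^sup>2 * (lam 1 + lam 3),
     lam 1 + lam 3 - (u \<bullet> v 3)\<^sup>2 * (lam 2 + lam 3) - (u \<bullet> v 1)\<^sup>2 * (lam 1 + lam 2),
     lam 1 + lam 2 - (u \<bullet> v 1)\<^sup>2 * (lam 1 + lam 3) - (u \<bullet> v 2)\<^sup>2 * (lam 2 + lam 3)}"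
    (is "_ = Min {?D1, ?D2, ?D3}")
proof -
  have E: "unit_eigenvectors A = {v 1, - v 1, v 2, - v 2, v 3, - v 3}"
  proof (intro equalityI subsetI)
    fix x assume "x \<in> unit_eigenvectors A"
    then obtain m where n: "norm x = 1" and m: "\<And>i. (lam i - m) * (x \<bullet> v i) = 0"
      by (auto simp: unit_eigenvector_iff)
    have inj: "lam i \<noteq> lam j" if "i \<noteq> j" for i j
      using exhaust_3[of i] exhaust_3[of j] that lt by auto
    have "x \<noteq> 0" using n by auto
    \<comment> \<open>A nonzero coordinate pins \<open>m\<close> to \<open>lam i\<close>;
      distinctness of the eigenvalues then annihilates all other coordinates.\<close>
    then obtain i where i: "x \<bullet> v i \<noteq> 0" using eigenbasis_eqI[of x 0] by auto
    then have "x \<bullet> v j = 0" if "j \<noteq> i" for j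
      using m[of i] m[of j] inj[OF that] by auto
    then have "x = v i \<or> x = - v i" using n unit_along_axis by blast
    then show "x \<in> {v 1, - v 1, v 2, - v 2, v 3, - v 3}" using exhaust_3[of i] by auto
  next
    have "v i \<in> unit_eigenvectors A \<and> - v i \<in> unit_eigenvectors A" for i
      using basis eigenbasis_eigen[of i]
      by (auto simp: unit_eigenvectors_def orthonormal_eigenbasis_def
          linear_neg[OF matrix_vector_mul_linear])
    then show "x \<in> unit_eigenvectors A" if "x \<in> {v 1, - v 1, v 2, - v 2, v 3, - v 3}" for x
      using that by blast
  qed
  \<comment> \<open>These decide the nested case distinction of \<open>Delta\<close> at each of the
    six eigenvectors.\<close>
  have neq: "v 2 \<noteq> v 1" "v 2 \<noteq> - v 1" "v 3 \<noteq> v 1" "v 3 \<noteq> - v 1" "v 3 \<noteq> v 2" "v 3 \<noteq> - v 2"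
    using eigenbasis_neq by simp_all
  then have neq': "- v 2 \<noteq> v 1" "- v 3 \<noteq> v 1" "- v 3 \<noteq> v 2"
    by (metis minus_minus)+
  have "(\<lambda>x. Delta A lam v x u) ` unit_eigenvectors A = {?D1, ?D2, ?D3}"
    using lt neq neq' by (simp add: E Delta_def lamW_eigenbasis insert_commute)
  then show ?thesis by (simp add: min_Delta_def cInf_eq_Min)
qed

section \<open>The inner minimum for two equal eigenvalues\<close>

lemma Delta_equal_pair_axis:
  assumes "lam 1 = lam 2" "lam 2 < lam 3" "x = v 3 \<or> x = - v 3"
  shows "Delta A lam v x u = 2 * lam 2 - (lam 2 + lam 3) * (1 - (u \<bullet> v 3)\<^sup>2)"
  using assms by (auto simp: Delta_def lamW_eigenbasis)

lemma span_eigenbasis_pair: "x \<in> span {v 1, v 2} \<longleftrightarrow> x \<bullet> v 3 = 0"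
proof
  assume "x \<in> span {v 1, v 2}"
  then have "orthogonal (v 3) x"
    by (rule orthogonal_to_span) (auto simp: orthogonal_def eigenbasis_inner)
  then show "x \<bullet> v 3 = 0" by (simp add: orthogonal_def inner_commute)
next
  assume "x \<bullet> v 3 = 0"
  then have "x = (x \<bullet> v 1) *\<^sub>R v 1 + (x \<bullet> v 2) *\<^sub>R v 2"
    using eigenbasis_expand[of x] by (simp add: sum_3)
  then show "x \<in> span {v 1, v 2}"
    by (metis insertI1 insertI2 span_add span_base span_scale)
qed

text \<open>Eliminates the angle: with \<open>p\<close> the projection of \<open>u\<close>,
  \<open>x \<bullet> p = x \<bullet> u\<close> gives that the squared norm of \<open>p\<close> times
  the squared sine is the squared norm of \<open>p\<close> minus
  \<open>(x \<bullet> u)\<^sup>2\<close>. For \<open>lam 2 > 0\<close> the resulting form is visibly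
  smallest where \<open>x\<close> is orthogonal to \<open>u\<close>.\<close>

lemma Delta_equal_pair_plane:
  assumes lt: "lam 1 = lam 2" "lam 2 < lam 3"
    and x: "norm x = 1" "x \<bullet> v 3 = 0" and u: "norm u = 1"
  shows "Delta A lam v x u = (1 - (u \<bullet> v 3)\<^sup>2) * (lam 3 - lam 2) + 2 * lam 2 * (x \<bullet> u)\<^sup>2"
proof -
  define p where "p = (u \<bullet> v 1) *\<^sub>R v 1 + (u \<bullet> v 2) *\<^sub>R v 2"
  have pv: "p \<bullet> v 1 = u \<bullet> v 1" "p \<bullet> v 2 = u \<bullet> v 2" "p \<bullet> v 3 = 0"
    by (simp_all add: p_def inner_add_left eigenbasis_inner)
  have w: "w \<bullet> p = w \<bullet> u" if "w \<bullet> v 3 = 0" for w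
    using inner_eigenbasis[of w p] inner_eigenbasis[of w u] that by (simp add: sum_3 pv)
  have proj: "orth_projection (span {v 1, v 2}) u = p"
    by (rule orth_projection_eqI)
      (auto simp: orthogonal_def inner_diff_right span_eigenbasis_pair pv w)
  have np: "(norm p)\<^sup>2 = 1 - (u \<bullet> v 3)\<^sup>2"
    using norm_eigenbasis[of p] norm_eigenbasis[of u] u by (simp add: pv)
  have "x \<noteq> v 3" "x \<noteq> - v 3" using x(2) by (auto simp: eigenbasis_inner)
  then have D: "Delta A lam v x u = (if p = 0 then 0 else (1 - (u \<bullet> v 3)\<^sup>2) *
      (lam 1 + lam 3 - (lam 1 + lam 2) * (sin (vec_angle x p))\<^sup>2))"
    using lt x by (simp add: Delta_def span_eigenbasis_pair proj lamW_eigenbasis Let_def)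
  show ?thesis
  proof (cases "p = 0")
    \<comment> \<open>The default value 0 agrees with the formula, since both of its terms vanish
      when \<open>u\<close> is parallel to \<open>v 3\<close>.\<close>
    case True
    then have "(u \<bullet> v 3)\<^sup>2 = 1" "x \<bullet> u = 0" using np w[OF x(2)] by auto
    then show ?thesis using D True by simp
  next
    case False
    then have "(norm p)\<^sup>2 * (sin (vec_angle x p))\<^sup>2 = (norm p)\<^sup>2 - (x \<bullet> u)\<^sup>2"
      using x by (simp add: sin_squared_vec_angle w right_diff_distrib power_divide)
    then have s: "(1 - (u \<bullet> v 3)\<^sup>2) * (sin (vec_angle x p))\<^sup>2 = (1 - (u \<bullet> v 3)\<^sup>2) - (x \<bullet> u)\<^sup>2"
      by (simp add: np)
    have "Delta A lam v x u = (1 - (u \<bullet> v 3)\<^sup>2) * (lam 2 + lam 3)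
        - 2 * lam 2 * ((1 - (u \<bullet> v 3)\<^sup>2) * (sin (vec_angle x p))\<^sup>2)"
      using D False lt by (simp add: algebra_simps)
    also have "\<dots> = (1 - (u \<bullet> v 3)\<^sup>2) * (lam 3 - lam 2) + 2 * lam 2 * (x \<bullet> u)\<^sup>2"
      unfolding s by (simp add: algebra_simps)
    finally show ?thesis .
  qed
qed

text \<open>The values on the axis and on the plane are bounded below by \<open>?D3\<close> and
  \<open>?D12\<close> respectively, and both bounds are attained: at \<open>v 3\<close>, and at a
  unit vector of the plane orthogonal to \<open>u\<close>.\<close>

lemma min_Delta_equal_pair:
  assumes lt: "0 < lam 1" "lam 1 = lam 2" "lam 2 < lam 3" and u: "norm u = 1"
  shows "min_Delta A lam v u =
    min (2 * lam 2 - (lam 2 + lam 3) * (1 - (u \<bullet> v 3)\<^sup>2)) ((1 - (u \<bullet> v 3)\<^sup>2) * (lam 3 - lam 2))"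
    (is "_ = min ?D3 ?D12")
proof -
  have v3: "v 3 \<in> unit_eigenvectors A"
    using basis by (auto simp: unit_eigenvectors_def orthonormal_eigenbasis_def)
  have D3: "Delta A lam v (v 3) u = ?D3" using lt Delta_equal_pair_axis by blast
  obtain y where y: "y \<in> unit_eigenvectors A" "Delta A lam v y u = ?D12"
  proof -
    \<comment> \<open>The projection of \<open>u\<close> turned by a right angle within the plane;
      if the projection vanishes, \<open>v 1\<close> is already orthogonal to
      \<open>u\<close>.\<close>
    define z where "z = (if u \<bullet> v 1 = 0 \<and> u \<bullet> v 2 = 0 then v 1
      else (u \<bullet> v 2) *\<^sub>R v 1 - (u \<bullet> v 1) *\<^sub>R v 2)"
    define y where "y = z /\<^sub>R norm z"
    have z: "z \<bullet> v 3 = 0" "z \<bullet> u = 0"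
      by (auto simp: z_def inner_diff_left eigenbasis_inner inner_commute[of "v _" u])
    have "z \<bullet> v 1 \<noteq> 0 \<or> z \<bullet> v 2 \<noteq> 0"
      by (auto simp: z_def inner_diff_left eigenbasis_inner)
    then have "z \<noteq> 0" by auto
    then have ny: "norm y = 1" by (simp add: y_def)
    have yz: "y \<bullet> v 3 = 0" "y \<bullet> u = 0" using z by (simp_all add: y_def)
    have "(lam i - lam 2) * (y \<bullet> v i) = 0" for i
      using exhaust_3[of i] lt yz by auto
    then have "y \<in> unit_eigenvectors A" using ny unit_eigenvector_iff by blast
    moreover have "Delta A lam v y u = ?D12"
      using Delta_equal_pair_plane[OF lt(2,3) ny yz(1) u] yz(2) by simp
    ultimately show thesis by (rule that)
  qed
  have lb: "min ?D3 ?D12 \<le> Delta A lam v x u" if x: "x \<in> unit_eigenvectors A" for x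
  proof -
    obtain m where n: "norm x = 1" and m: "\<And>i. (lam i - m) * (x \<bullet> v i) = 0"
      using x unfolding unit_eigenvector_iff by blast
    show ?thesis
    proof (cases "x \<bullet> v 3 = 0")
      case True
      then have "?D12 \<le> Delta A lam v x u"
        using Delta_equal_pair_plane[OF lt(2,3) n True u] lt by simp
      then show ?thesis by linarith
    next
      case False
      \<comment> \<open>Since \<open>lam 3\<close> differs from the repeated eigenvalue, the
        coordinates in the plane must vanish and \<open>x\<close> lies on the axis.\<close>
      then have "m = lam 3" using m[of 3] by simp
      then have "x \<bullet> v j = 0" if "j \<noteq> 3" for j
        using m[of j] that exhaust_3[of j] lt by auto
      then have "x = v 3 \<or> x = - v 3" using n unit_along_axis by blast
      then show ?thesis using Delta_equal_pair_axis[OF lt(2,3)] by auto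
    qed
  qed
  have bdd: "bdd_below ((\<lambda>x. Delta A lam v x u) ` unit_eigenvectors A)"
    using lb by (rule bdd_belowI2)
  show ?thesis
    unfolding min_Delta_def
  proof (rule antisym)
    show "(INF x\<in>unit_eigenvectors A. Delta A lam v x u) \<le> min ?D3 ?D12"
      using cINF_lower[OF bdd v3] cINF_lower[OF bdd y(1)] D3 y(2) by simp
    show "min ?D3 ?D12 \<le> (INF x\<in>unit_eigenvectors A. Delta A lam v x u)"
      using v3 lb by (intro cINF_greatest) auto
  qed
qed

section \<open>Coordinates of the maximizers\<close>

lemma maximizer_equal_pair:
  assumes lt: "0 < lam 1" "lam 1 = lam 2" "lam 2 < lam 3" and sol: "solves_maxmin A lam v u"
  shows "(u \<bullet> v 3)\<^sup>2 = 1 - lam 2 / lam 3"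
proof -
  have u: "norm u = 1" using sol by (simp add: solves_maxmin_def is_arg_max_def)
  \<comment> \<open>Only the third coordinate matters for the minimum, so the remaining mass is put
    on \<open>v 1\<close> alone.\<close>
  obtain w where w: "norm w = 1" "(w \<bullet> v 3)\<^sup>2 = 1 - lam 2 / lam 3"
    using exists_unit_vector_coordinates[of "lam 2 / lam 3" 0 "1 - lam 2 / lam 3"] lt
    by auto
  have "min_Delta A lam v w = (lam 3 - lam 2) * lam 2 / lam 3"
    unfolding min_Delta_equal_pair[OF lt w(1)] w(2) using lt by (simp add: field_simps)
  then have "(lam 3 - lam 2) * lam 2 / lam 3 \<le> min_Delta A lam v u"
    using solves_maxmin_ge[OF sol w(1)] by simp
  then show ?thesis
    using lt min_Delta_equal_pair[OF lt u] by (intro maxmin_equal_pair) auto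
qed

text \<open>At the claimed point the functions of \<open>v 2\<close> and \<open>v 3\<close> both
  equal \<open>lam 1\<close>. The case condition says exactly that the function of
  \<open>v 1\<close> is at least \<open>lam 1\<close> there, so a maximizer attains at least
  \<open>lam 1\<close> and \<open>maxmin_boundary\<close> applies.\<close>

lemma maximizer_distinct_boundary:
  assumes lt: "0 < lam 1" "lam 1 < lam 2" "lam 2 < lam 3" and sol: "solves_maxmin A lam v u"
    and ge: "lam 2 \<ge> lam 1 * lam 3 / (lam 3 - lam 1)"
  shows "u \<bullet> v 1 = 0" "(u \<bullet> v 2)\<^sup>2 = lam 2 / (lam 2 + lam 3)"
    "(u \<bullet> v 3)\<^sup>2 = lam 3 / (lam 2 + lam 3)"
proof -
  have u: "norm u = 1" using sol by (simp add: solves_maxmin_def is_arg_max_def)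
  obtain w where w: "norm w = 1" "(w \<bullet> v 1)\<^sup>2 = 0" "(w \<bullet> v 2)\<^sup>2 = lam 2 / (lam 2 + lam 3)"
      "(w \<bullet> v 3)\<^sup>2 = lam 3 / (lam 2 + lam 3)"
    using exists_unit_vector_coordinates[of 0 "lam 2 / (lam 2 + lam 3)" "lam 3 / (lam 2 + lam 3)"] lt
    by (auto simp: add_divide_distrib[symmetric])
  have "lam 1 * lam 3 \<le> lam 2 * (lam 3 - lam 1)"
    using ge lt by (simp add: divide_le_eq)
  then have "lam 1 \<le> lam 2 * lam 3 / (lam 2 + lam 3)"
    using lt by (simp add: le_divide_eq algebra_simps)
  moreover have "lam 2 + lam 3 - lam 2 / (lam 2 + lam 3) * (lam 1 + lam 2)
      - lam 3 / (lam 2 + lam 3) * (lam 1 + lam 3) = 2 * (lam 2 * lam 3 / (lam 2 + lam 3)) - lam 1"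
    using lt by (simp add: divide_simps) (simp add: algebra_simps)
  ultimately have "lam 1 \<le> lam 2 + lam 3 - lam 2 / (lam 2 + lam 3) * (lam 1 + lam 2)
      - lam 3 / (lam 2 + lam 3) * (lam 1 + lam 3)"
    by linarith
  then have "lam 1 \<le> min_Delta A lam v w"
    using lt by (simp add: min_Delta_distinct[OF lt] w)
  then have *: "lam 1 \<le> min_Delta A lam v u"
    using solves_maxmin_ge[OF sol w(1)] by simp
  have "(u \<bullet> v 1)\<^sup>2 + (u \<bullet> v 2)\<^sup>2 + (u \<bullet> v 3)\<^sup>2 = 1" using norm_eigenbasis[of u] u by simp
  then have "(u \<bullet> v 1)\<^sup>2 = 0 \<and> (u \<bullet> v 2)\<^sup>2 = lam 2 / (lam 2 + lam 3) \<and>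
      (u \<bullet> v 3)\<^sup>2 = lam 3 / (lam 2 + lam 3)"
    using maxmin_boundary[of "lam 1" "lam 2" "lam 3" "(u \<bullet> v 1)\<^sup>2" "(u \<bullet> v 2)\<^sup>2" "(u \<bullet> v 3)\<^sup>2"] lt *
    by (simp add: min_Delta_distinct[OF lt])
  then show "u \<bullet> v 1 = 0" "(u \<bullet> v 2)\<^sup>2 = lam 2 / (lam 2 + lam 3)"
    "(u \<bullet> v 3)\<^sup>2 = lam 3 / (lam 2 + lam 3)" by auto
qed

text \<open>All three functions agree at the claimed point, with the value required by
  \<open>maxmin_interior\<close>; what must be checked is that this point lies in the
  simplex.\<close>

lemma maximizer_distinct_interior:
  defines "S \<equiv> lam 1 * lam 2 + lam 2 * lam 3 + lam 3 * lam 1"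
  assumes lt: "0 < lam 1" "lam 1 < lam 2" "lam 2 < lam 3" and sol: "solves_maxmin A lam v u"
    and less: "lam 2 < lam 1 * lam 3 / (lam 3 - lam 1)"
  shows "(u \<bullet> v 1)\<^sup>2 = 1 - 2 * (lam 2 * lam 3) / S" "(u \<bullet> v 2)\<^sup>2 = 1 - 2 * (lam 1 * lam 3) / S"
    "(u \<bullet> v 3)\<^sup>2 = 1 - 2 * (lam 1 * lam 2) / S"
proof -
  have u: "norm u = 1" using sol by (simp add: solves_maxmin_def is_arg_max_def)
  have S: "S > 0" using lt by (simp add: S_def add_pos_pos)
  have prods: "lam 1 * lam 3 < lam 2 * lam 3" "lam 1 * lam 2 < lam 1 * lam 3"
    "0 < lam 1 * lam 2" "lam 2 * (lam 3 - lam 1) < lam 1 * lam 3"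
    using less lt by (simp_all add: less_divide_eq)
  \<comment> \<open>Nonnegativity of the first coordinate means
    \<open>lam 2 * (lam 3 - lam 1) \<le> lam 1 * lam 3\<close>, which is where the case condition
    enters; the other two follow from the ordering of the eigenvalues.\<close>
  have nonneg: "0 \<le> 1 - 2 * (lam 2 * lam 3) / S" "0 \<le> 1 - 2 * (lam 1 * lam 3) / S"
      "0 \<le> 1 - 2 * (lam 1 * lam 2) / S"
    using prods S by (simp_all add: divide_le_eq_1, simp_all add: S_def algebra_simps)
  have sum: "1 - 2 * (lam 2 * lam 3) / S + (1 - 2 * (lam 1 * lam 3) / S)
      + (1 - 2 * (lam 1 * lam 2) / S) = 1"
    using S by (simp add: field_simps) (simp add: S_def algebra_simps)
  obtain w where w: "norm w = 1" "(w \<bullet> v 1)\<^sup>2 = 1 - 2 * (lam 2 * lam 3) / S"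
      "(w \<bullet> v 2)\<^sup>2 = 1 - 2 * (lam 1 * lam 3) / S" "(w \<bullet> v 3)\<^sup>2 = 1 - 2 * (lam 1 * lam 2) / S"
    using exists_unit_vector_coordinates[OF nonneg sum] .
  have "min_Delta A lam v w = 2 * lam 1 * lam 2 * lam 3 / S"
  proof -
    \<comment> \<open>\<open>S\<close> is invariant under cyclic shifts, so one identity, used in
      its three rotations, evaluates all three functions.\<close>
    have "b + c - (1 - 2 * (a * c) / S) * (a + b) - (1 - 2 * (a * b) / S) * (a + c)
        = 2 * a * b * c / S" if "S = a * b + b * c + c * a" for a b c
      using S by (simp add: field_simps) (simp add: that algebra_simps)
    from this[of "lam 1" "lam 2" "lam 3"] this[of "lam 2" "lam 3" "lam 1"]
      this[of "lam 3" "lam 1" "lam 2"]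
    show ?thesis
      by (simp add: min_Delta_distinct[OF lt] w) (simp add: S_def algebra_simps)
  qed
  then have *: "2 * lam 1 * lam 2 * lam 3 / S \<le> min_Delta A lam v u"
    using solves_maxmin_ge[OF sol w(1)] by simp
  have "(u \<bullet> v 1)\<^sup>2 + (u \<bullet> v 2)\<^sup>2 + (u \<bullet> v 3)\<^sup>2 = 1" using norm_eigenbasis[of u] u by simp
  then show "(u \<bullet> v 1)\<^sup>2 = 1 - 2 * (lam 2 * lam 3) / S"
    "(u \<bullet> v 2)\<^sup>2 = 1 - 2 * (lam 1 * lam 3) / S"
    "(u \<bullet> v 3)\<^sup>2 = 1 - 2 * (lam 1 * lam 2) / S"
    using maxmin_interior[of "lam 1" "lam 2" "lam 3" "(u \<bullet> v 1)\<^sup>2" "(u \<bullet> v 2)\<^sup>2" "(u \<bullet> v 3)\<^sup>2"] lt *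
    by (simp_all add: min_Delta_distinct[OF lt] S_def)
qed

end

section \<open>The symmetric form of the answer and the final statement\<close>

text \<open>Each unordered pair is counted twice, which reconciles the factor 4 of the theorem with
  the factor 2 in \<open>maximizer_distinct_interior\<close>.\<close>

lemma sum_distinct_pairs_3:
  fixes f :: "3 \<Rightarrow> real"
  shows "(\<Sum>(j, k)\<in>{(j, k). j \<noteq> k}. f j * f k) = 2 * (f 1 * f 2 + f 2 * f 3 + f 3 * f 1)"
proof -
  have "{(j, k). j \<noteq> k} = {(1, 2), (1, 3), (2, 1), (2, 3), (3, 1), (3, 2::3)}"
    by (auto; metis exhaust_3)
  then show ?thesis by (simp add: algebra_simps)
qed

theorem proposition2:
  fixes A :: "real^3^3" and lam :: "3 \<Rightarrow> real" and v :: "3 \<Rightarrow> real^3" and u :: "real^3"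
  assumes "transpose A = A"
    and "transpose (W_matrix A) = W_matrix A" and "positive_definite (W_matrix A)"
    and "orthonormal_eigenbasis A lam v"
    and "solves_maxmin A lam v u"
  shows "(0 < lam 1 \<and> lam 1 = lam 2 \<and> lam 2 < lam 3 \<longrightarrow>
            (u \<bullet> v 3)\<^sup>2 = 1 - lam 2 / lam 3)
       \<and> (0 < lam 1 \<and> lam 1 < lam 2 \<and> lam 2 < lam 3 \<longrightarrow>
            (if lam 2 \<ge> lam 1 * lam 3 / (lam 3 - lam 1) then
               u \<bullet> v 1 = 0
               \<and> (u \<bullet> v 2)\<^sup>2 = lam 2 / (lam 2 + lam 3)
               \<and> (u \<bullet> v 3)\<^sup>2 = lam 3 / (lam 2 + lam 3)
             else
               (\<forall>i. (u \<bullet> v i)\<^sup>2 =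
                  1 - 4 * (\<Prod>j\<in>UNIV - {i}. lam j)
                        / (\<Sum>(j, k)\<in>{(j, k). j \<noteq> k}. lam j * lam k))))"
proof -
  have diff: "UNIV - {1::3} = {2, 3}" "UNIV - {2::3} = {1, 3}" "UNIV - {3::3} = {1, 2}"
    by (auto; metis exhaust_3)+
  have half: "4 * p / (2 * q) = 2 * p / q" for p q :: real by simp
  have "(u \<bullet> v i)\<^sup>2 = 1 - 4 * (\<Prod>j\<in>UNIV - {i}. lam j)
      / (\<Sum>(j, k)\<in>{(j, k). j \<noteq> k}. lam j * lam k)"
    if "0 < lam 1" "lam 1 < lam 2" "lam 2 < lam 3" "lam 2 < lam 1 * lam 3 / (lam 3 - lam 1)" for i
    using maximizer_distinct_interior[OF assms(4) that(1-3) assms(5) that(4)] exhaust_3[of i]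
    unfolding sum_distinct_pairs_3 by (auto simp: diff half simp del: distrib_left_numeral)
  then show ?thesis
    using maximizer_equal_pair[OF assms(4) _ _ _ assms(5)]
      maximizer_distinct_boundary[OF assms(4) _ _ _ assms(5)]
    by (auto simp: not_le)
qed

end
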